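(* Let $(M^d,g_M)$ be a smooth compact connected Riemannian manifold without boundary with Laplace eigenvalues $0=\lambda_0\le\lambda_1\le\cdots$ (repeated according to multiplicity), spectral measure $\mu_\Delta=\sum_n\delta_{\lambda_n}$, and $N_\Delta(\Lambda)=\#\{n:\lambda_n\le\Lambda\}\sim\gamma_d\Lambda^{d/2}$ as $\Lambda\to\infty$, $\gamma_d>0$. Let $g(\lambda)=a-\phi(\lambda)$, $a\in\mathbb R$, be ultimately strictly decreasing with $\phi\in\mathrm{RV}_k$, $k>0$, and let $\mu_g$ be the pushforward of $\mu_\Delta$ under $g$, with counting function $N_{\mu_g}(C)=\#\{n:g(\lambda_n)\ge C\}$. Then, as a function of $x\to\infty$, $$N_{\mu_g}(a-x)\in\mathrm{RV}_{d/(2k)},$$ so $g$ induces a map between asymptotic classes $T_g:[\mu_\Delta]_{\mathrm{as},\,d/2}\to[\mu_g]_{\mathrm{as},\,d/(2k)}$, and therefore acts on asymptotic spectral dimension by $d_{\mathrm{as}}\mapsto\frac1k d_{\mathrm{as}}$; that is, $d_{\mathrm{as}}(\mu_g)=\frac1k d_{\mathrm{as}}(\mu_\Delta)=d/k$.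
   Context: A positive measurable $f$ is in $\mathrm{RV}_\alpha$ if $f(tu)/f(t)\to u^\alpha$ as $t\to\infty$ for each $u>0$. For positive spectral measures $\mu_1,\mu_2$ with ultimately monotone counting functions $N_1,N_2$ and $\beta>0$, write $\mu_1\sim_{\mathrm{as},\beta}\mu_2$ if $N_1\in\mathrm{RV}_\beta$ and $N_2\in\mathrm{RV}_\beta$; the class is $[\mu]_{\mathrm{as},\beta}$. If $N_\mu\in\mathrm{RV}_\beta$, the asymptotic spectral dimension is $d_{\mathrm{as}}(\mu)=2\beta$. For $\mu_\Delta$ the counting function is $N_\Delta$; for $\mu_g$ it is $x\mapsto N_{\mu_g}(a-x)$. *)

theory Defs
  imports "HOL-Analysis.Analysis" "HOL-Library.Landau_Symbols" "HOL-Library.Function_Algebras"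
begin

section \<open>Smooth functions on open subsets of Euclidean space\<close>

definition partial_deriv :: "'d \<Rightarrow> (real ^ 'd \<Rightarrow> real) \<Rightarrow> real ^ 'd \<Rightarrow> real" where
  "partial_deriv i f x = deriv (\<lambda>t. f (x + t *\<^sub>R axis i 1)) 0"

text \<open>These notions are only meaningful, and only used, for open \<open>S\<close>.\<close>

fun Ck_on :: "nat \<Rightarrow> (real ^ 'd) set \<Rightarrow> (real ^ 'd \<Rightarrow> real) \<Rightarrow> bool" where
  "Ck_on 0 S f \<longleftrightarrow> continuous_on S f"
| "Ck_on (Suc n) S f \<longleftrightarrow> f differentiable_on S \<and> (\<forall>i. Ck_on n S (partial_deriv i f))"

definition smooth_on :: "(real ^ 'd) set \<Rightarrow> (real ^ 'd \<Rightarrow> real) \<Rightarrow> bool" where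
  "smooth_on S f \<longleftrightarrow> (\<forall>n. Ck_on n S f)"

section \<open>Closed Riemannian manifolds\<close>

text \<open>A chart of the space \<open>X\<close> is a pair of its domain and its coordinate map. The values of the
  coordinate map outside the domain are irrelevant.\<close>

type_synonym ('m, 'd) chart = "'m set \<times> ('m \<Rightarrow> real ^ 'd)"

definition coord_dom :: "('m, 'd) chart \<Rightarrow> (real ^ 'd) set" where
  "coord_dom c = snd c ` fst c"

definition chart_inv :: "('m, 'd) chart \<Rightarrow> real ^ 'd \<Rightarrow> 'm" where
  "chart_inv c = inv_into (fst c) (snd c)"

definition is_chart :: "'m topology \<Rightarrow> ('m, 'd::finite) chart \<Rightarrow> bool" where
  "is_chart X c \<longleftrightarrow> openin X (fst c) \<and> open (coord_dom c) \<and>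
     homeomorphic_map (subtopology X (fst c)) (top_of_set (coord_dom c)) (snd c)"

definition transition :: "('m, 'd) chart \<Rightarrow> ('m, 'd) chart \<Rightarrow> real ^ 'd \<Rightarrow> real ^ 'd" where
  "transition c c' = snd c' \<circ> chart_inv c"

definition overlap :: "('m, 'd) chart \<Rightarrow> ('m, 'd) chart \<Rightarrow> (real ^ 'd) set" where
  "overlap c c' = snd c ` (fst c \<inter> fst c')"

definition jacobian :: "(real ^ 'd \<Rightarrow> real ^ 'd) \<Rightarrow> real ^ 'd \<Rightarrow> real ^ 'd ^ 'd" where
  "jacobian \<tau> x = (\<chi> i j. partial_deriv j (\<lambda>y. \<tau> y $ i) x)"

text \<open>The smooth structure is the one generated by the atlas \<open>A\<close>, which need not be maximal.
  The Riemannian metric is given by its coefficient matrices \<open>G c x\<close> in the coordinates of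
  each chart \<open>c\<close>; the last assumption is the transformation law of a covariant 2-tensor.\<close>

locale closed_riemannian_manifold =
  fixes X :: "'m topology"
    and A :: "('m, 'd::finite) chart set"
    and G :: "('m, 'd) chart \<Rightarrow> real ^ 'd \<Rightarrow> real ^ 'd ^ 'd"
  assumes nonempty: "topspace X \<noteq> {}"
    and Hausdorff: "Hausdorff_space X"
    and second_countable: "second_countable X"
    and compact: "compact_space X"
    and connected: "connected_space X"
    and charts: "c \<in> A \<Longrightarrow> is_chart X c"
    and covering: "(\<Union>c\<in>A. fst c) = topspace X"
    and smooth_transition:
      "c \<in> A \<Longrightarrow> c' \<in> A \<Longrightarrow> smooth_on (overlap c c') (\<lambda>x. transition c c' x $ i)"
    and metric_smooth: "c \<in> A \<Longrightarrow> smooth_on (coord_dom c) (\<lambda>x. G c x $ i $ j)"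
    and metric_symmetric: "c \<in> A \<Longrightarrow> x \<in> coord_dom c \<Longrightarrow> transpose (G c x) = G c x"
    and metric_positive:
      "c \<in> A \<Longrightarrow> x \<in> coord_dom c \<Longrightarrow> v \<noteq> 0 \<Longrightarrow> v \<bullet> (G c x *v v) > 0"
    and metric_transform:
      "c \<in> A \<Longrightarrow> c' \<in> A \<Longrightarrow> x \<in> overlap c c' \<Longrightarrow>
        G c x = transpose (jacobian (transition c c') x) ** G c' (transition c c' x)
                  ** jacobian (transition c c') x"

section \<open>The Laplace--Beltrami operator and its eigenvalues\<close>

definition smooth_function :: "('m, 'd::finite) chart set \<Rightarrow> ('m \<Rightarrow> real) \<Rightarrow> bool" where
  "smooth_function A f \<longleftrightarrow> (\<forall>c\<in>A. smooth_on (coord_dom c) (f \<circ> chart_inv c))"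

text \<open>The geometers' Laplacian \<open>- div grad\<close>, which is nonnegative, in local coordinates:
  \<open>- (det G) powr (-1/2) * (\<Sum>i. \<partial>\<^sub>i (sqrt (det G) * (\<Sum>j. G\<^sup>i\<^sup>j * \<partial>\<^sub>j u)))\<close>.\<close>

definition local_laplacian ::
    "(real ^ 'd \<Rightarrow> real ^ 'd ^ 'd) \<Rightarrow> (real ^ 'd \<Rightarrow> real) \<Rightarrow> real ^ 'd \<Rightarrow> real" where
  "local_laplacian H u x =
     - (\<Sum>i\<in>UNIV. partial_deriv i
           (\<lambda>y. sqrt (det (H y)) * (\<Sum>j\<in>UNIV. matrix_inv (H y) $ i $ j * partial_deriv j u y)) x)
       / sqrt (det (H x))"

text \<open>Functions on the manifold are represented by functions on the type \<open>'m\<close> that vanish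
  outside the carrier \<open>topspace X\<close>, so that dimensions are those of function spaces on the
  manifold.\<close>

definition eigenspace ::
    "'m topology \<Rightarrow> ('m, 'd::finite) chart set \<Rightarrow> (('m, 'd) chart \<Rightarrow> real ^ 'd \<Rightarrow> real ^ 'd ^ 'd)
      \<Rightarrow> real \<Rightarrow> ('m \<Rightarrow> real) set" where
  "eigenspace X A G l = {f. smooth_function A f \<and> (\<forall>p. p \<notin> topspace X \<longrightarrow> f p = 0) \<and>
     (\<forall>c\<in>A. \<forall>x\<in>coord_dom c.
        local_laplacian (G c) (f \<circ> chart_inv c) x = l * f (chart_inv c x))}"

definition fun_scale :: "real \<Rightarrow> ('m \<Rightarrow> real) \<Rightarrow> 'm \<Rightarrow> real" where
  "fun_scale r f = (\<lambda>p. r * f p)"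

interpretation fun_space: vector_space fun_scale
  by unfold_locales (auto simp: fun_scale_def fun_eq_iff algebra_simps)

text \<open>\<open>lam\<close> lists all eigenvalues in nondecreasing order, repeated according to multiplicity: each
  real number \<open>l\<close> occurs exactly as often as the dimension of its (finite-dimensional, possibly
  trivial) eigenspace. Finite dimensionality is explicit because \<open>dim\<close> is 0 on
  infinite-dimensional spaces.\<close>

definition laplace_eigenvalues ::
    "'m topology \<Rightarrow> ('m, 'd::finite) chart set \<Rightarrow> (('m, 'd) chart \<Rightarrow> real ^ 'd \<Rightarrow> real ^ 'd ^ 'd)
      \<Rightarrow> (nat \<Rightarrow> real) \<Rightarrow> bool" where
  "laplace_eigenvalues X A G lam \<longleftrightarrow> mono lam \<and> lam 0 = 0 \<and>
     (\<forall>l. (\<exists>B. finite B \<and> fun_space.span B = eigenspace X A G l) \<and>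
          finite {n. lam n = l} \<and> card {n. lam n = l} = fun_space.dim (eigenspace X A G l))"

section \<open>Regular variation\<close>

text \<open>Positivity is only required near infinity: counting functions vanish below the bottom of
  the spectrum.\<close>

definition RV :: "real \<Rightarrow> (real \<Rightarrow> real) set" where
  "RV \<alpha> = {f. f \<in> borel_measurable borel \<and> (\<forall>\<^sub>F t in at_top. f t > 0) \<and>
      (\<forall>u>0. ((\<lambda>t. f (t * u) / f t) \<longlongrightarrow> u powr \<alpha>) at_top)}"

section \<open>Spectral measures, counting functions and asymptotic classes\<close>

text \<open>The measure \<open>\<Sum>n. \<delta>\<^bsub>lam n\<^esub>\<close>; see \<open>emeasure_spectral_measure\<close>.\<close>

definition spectral_measure :: "(nat \<Rightarrow> real) \<Rightarrow> real measure" where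
  "spectral_measure lam = distr (count_space UNIV) borel lam"

lemma emeasure_spectral_measure:
  assumes "S \<in> sets borel"
  shows "emeasure (spectral_measure lam) S = (\<Sum>n. indicator S (lam n))"
proof -
  have "emeasure (spectral_measure lam) S = emeasure (count_space UNIV) (lam -` S)"
    using assms by (simp add: spectral_measure_def emeasure_distr)
  also have "\<dots> = (\<integral>\<^sup>+ n. indicator (lam -` S) n \<partial>count_space UNIV)"
    by simp
  also have "\<dots> = (\<Sum>n. indicator (lam -` S) n)"
    by (rule nn_integral_count_space_nat)
  finally show ?thesis
    by (simp add: indicator_def)
qed

text \<open>A convention for counting is a family \<open>W\<close> of half-lines growing with \<open>x\<close>. For \<open>\<mu>\<^sub>\<Delta>\<close> it is
  \<open>below\<close>, with counting function \<open>x \<mapsto> \<mu> (-\<infinity>, x]\<close>; for \<open>\<mu>\<^sub>g\<close> it is \<open>above a\<close>, with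
  counting function \<open>x \<mapsto> N (a - x)\<close> where \<open>N C = \<mu> [C, \<infinity>)\<close>.\<close>

definition below :: "real \<Rightarrow> real set" where
  "below x = {..x}"

definition above :: "real \<Rightarrow> real \<Rightarrow> real set" where
  "above a x = {a - x..}"

definition counting :: "(real \<Rightarrow> real set) \<Rightarrow> real measure \<Rightarrow> real \<Rightarrow> real" where
  "counting W \<mu> x = measure \<mu> (W x)"

lemma counting_spectral_measure:
  assumes "finite {n. lam n \<in> W x}" "W x \<in> sets borel"
  shows "counting W (spectral_measure lam) x = real (card {n. lam n \<in> W x})"
  using assms
  by (simp add: counting_def spectral_measure_def measure_distr vimage_def measure_count_space)

definition counted_by :: "(real \<Rightarrow> real set) \<Rightarrow> real measure \<Rightarrow> bool" where
  "counted_by W \<mu> \<longleftrightarrow> sets \<mu> = sets borel \<and> (\<forall>x. emeasure \<mu> (W x) < \<infinity>) \<and>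
     (\<exists>x\<^sub>0. mono_on {x\<^sub>0..} (counting W \<mu>))"

definition as_equiv :: "(real \<Rightarrow> real set) \<Rightarrow> real \<Rightarrow> real measure \<Rightarrow> real measure \<Rightarrow> bool" where
  "as_equiv W \<beta> \<mu>\<^sub>1 \<mu>\<^sub>2 \<longleftrightarrow> \<beta> > 0 \<and> counted_by W \<mu>\<^sub>1 \<and> counted_by W \<mu>\<^sub>2 \<and>
     counting W \<mu>\<^sub>1 \<in> RV \<beta> \<and> counting W \<mu>\<^sub>2 \<in> RV \<beta>"

definition as_class :: "(real \<Rightarrow> real set) \<Rightarrow> real \<Rightarrow> real measure \<Rightarrow> real measure set" where
  "as_class W \<beta> \<mu> = {\<nu>. as_equiv W \<beta> \<mu> \<nu>}"

text \<open>Meaningful only if the counting function is regularly varying (the index is then unique).\<close>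

definition as_dim :: "(real \<Rightarrow> real set) \<Rightarrow> real measure \<Rightarrow> real" where
  "as_dim W \<mu> = 2 * (THE \<beta>. counting W \<mu> \<in> RV \<beta>)"

end

theory Submission
  imports Defs
begin

text \<open>
  The count \<open>N\<^sub>g (a - x)\<close> is the mass that the original measure gives to the sublevel set
  \<open>{\<phi> \<le> x}\<close>. As \<open>\<phi>\<close> is ultimately increasing, this set agrees, up to a bounded part of finite mass,
  with a half-line that ends at \<open>h x\<close>, where \<open>h\<close> is the generalised inverse of \<open>\<phi>\<close>. Heuristically
  the count is therefore \<open>N (h x)\<close>; the function \<open>h\<close> varies regularly with index \<open>1 / k\<close>, \<open>N\<close>
  with index \<open>\<beta>\<close>, and the indices multiply.

  The function \<open>\<phi>\<close> need not be continuous, so \<open>\<phi> (h x) = x\<close> may fail; and the pointwise limits of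
  \<open>N (t * u) / N t\<close> do not directly give that of \<open>N (h (u * x)) / N (h x)\<close>, whose arguments have a
  quotient that depends on \<open>x\<close>. Monotonicity overcomes both difficulties. Comparing
  \<open>\<phi>\<close> at a point slightly beyond, or slightly short of, \<open>h x\<close> with its value at a fixed multiple
  of that point shows that the level \<open>u * x\<close> is crossed between \<open>v * h x\<close> and \<open>w * h x\<close>
  whenever \<open>v < u powr (1 / k) < w\<close> and \<open>x\<close> is large (lemmas \<open>below_level_at_multiple_of_inverse\<close> and
  \<open>above_level_at_multiple_of_inverse\<close>). Hence the mass of \<open>{\<phi> \<le> u * x}\<close>, divided by \<open>N (h x)\<close>, is
  squeezed between quantities that tend to \<open>v powr \<beta>\<close> and \<open>w powr \<beta>\<close>, so it tends to
  \<open>u powr (\<beta> / k)\<close> (lemma \<open>mass_sublevel_over_inverse_tendsto\<close>). Dividing this limit by the one for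
  \<open>u = 1\<close> eliminates \<open>h\<close>.

  This argument applies to every measure in the asymptotic class, not only to the spectral measure of
  the Laplacian. What is special to the latter is that the assumed asymptotics of its counting function
  make all counts finite and give the index \<open>d / 2\<close>.
\<close>

section \<open>Regularly varying functions\<close>

lemma RV_pos: "f \<in> RV \<alpha> \<Longrightarrow> \<forall>\<^sub>F t in at_top. f t > 0"
  by (simp add: RV_def)

lemma RV_tendsto: "f \<in> RV \<alpha> \<Longrightarrow> u > 0 \<Longrightarrow> ((\<lambda>t. f (t * u) / f t) \<longlongrightarrow> u powr \<alpha>) at_top"
  by (simp add: RV_def)

lemma RV_tendsto_along:
  assumes "f \<in> RV \<alpha>" "u > 0" "filterlim y at_top F"
  shows "((\<lambda>x. f (u * y x) / f (y x)) \<longlongrightarrow> u powr \<alpha>) F"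
  using filterlim_compose[OF RV_tendsto[OF assms(1,2)] assms(3)] by (simp add: mult.commute)

lemma RV_index_unique:
  assumes "f \<in> RV \<alpha>" "f \<in> RV \<beta>"
  shows "\<alpha> = \<beta>"
proof -
  have "(2::real) powr \<alpha> = 2 powr \<beta>"
    using tendsto_unique[OF _ RV_tendsto[OF assms(1)] RV_tendsto[OF assms(2)], of 2] by simp
  then show ?thesis
    by (simp add: powr_inj)
qed

lemma as_dim_eq:
  assumes "counting W \<mu> \<in> RV \<beta>"
  shows "as_dim W \<mu> = 2 * \<beta>"
proof -
  have "(THE \<beta>. counting W \<mu> \<in> RV \<beta>) = \<beta>"
    using assms by (rule the_equality) (rule RV_index_unique[OF _ assms])
  then show ?thesis
    by (simp add: as_dim_def)
qed

text \<open>An ultimately increasing function either diverges or stays below its supremum. In the second case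
  doubling the argument near the supremum would push the value above it, since \<open>2 powr \<alpha> > 1\<close>.\<close>

lemma RV_mono_at_top:
  assumes f: "f \<in> RV \<alpha>" and \<alpha>: "\<alpha> > 0" and mono: "mono_on {x\<^sub>0..} f"
  shows "filterlim f at_top at_top"
proof -
  obtain c where c: "1 < c" "c < (2::real) powr \<alpha>"
    using dense[of 1 "(2::real) powr \<alpha>"] \<alpha> by auto
  have "\<forall>\<^sub>F t in at_top. f (t * 2) / f t > c"
    using order_tendstoD(1)[OF RV_tendsto[OF f, of 2] c(2)] by simp
  then have "\<forall>\<^sub>F t in at_top. f (t * 2) > c * f t \<and> f t > 0"
    using RV_pos[OF f] by eventually_elim (simp add: field_simps)
  then obtain T where T: "\<And>t. t \<ge> T \<Longrightarrow> f (t * 2) > c * f t \<and> f t > 0"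
    by (auto simp: eventually_at_top_linorder)
  define t\<^sub>0 where "t\<^sub>0 = max T (max x\<^sub>0 0)"
  have step: "f (t * 2) > c * f t" "f t > 0" if "t \<ge> t\<^sub>0" for t
    using T[of t] that by (auto simp: t\<^sub>0_def)
  have monoD: "f s \<le> f t" if "t\<^sub>0 \<le> s" "s \<le> t" for s t
    using mono that by (auto simp: t\<^sub>0_def mono_on_def)
  have unbounded: "\<exists>t\<ge>t\<^sub>0. f t > Z" for Z
  proof (rule ccontr)
    assume "\<not> (\<exists>t\<ge>t\<^sub>0. f t > Z)"
    then have bdd: "bdd_above (f ` {t\<^sub>0..})"
      by (auto intro!: bdd_aboveI[of _ Z] simp: not_less)
    define L where "L = Sup (f ` {t\<^sub>0..})"
    have L: "f t \<le> L" if "t \<ge> t\<^sub>0" for t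
      unfolding L_def using bdd that by (auto intro: cSUP_upper)
    have "L > 0"
      using L[of t\<^sub>0] step(2)[of t\<^sub>0] by simp
    then have "L / c < L"
      using c by (simp add: field_simps)
    then obtain t where t: "t \<ge> t\<^sub>0" "L / c < f t"
      unfolding L_def using less_cSup_iff[OF _ bdd] by auto
    have "t * 2 \<ge> t\<^sub>0"
      using t(1) by (auto simp: t\<^sub>0_def)
    then have "L < f (t * 2)"
      using t step(1)[OF t(1)] c by (simp add: field_simps)
    with L[OF \<open>t * 2 \<ge> t\<^sub>0\<close>] show False
      by simp
  qed
  show ?thesis
    unfolding filterlim_at_top
  proof
    fix Z
    obtain t where "t \<ge> t\<^sub>0" "f t > Z"
      using unbounded by blast
    then show "\<forall>\<^sub>F s in at_top. Z \<le> f s"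
      using monoD by (intro eventually_at_top_linorderI[of t]) (meson less_imp_le order_trans)
  qed
qed

lemma asymp_equiv_power_imp_RV:
  assumes meas: "f \<in> borel_measurable borel" and c: "c > 0"
    and equiv: "f \<sim>[at_top] (\<lambda>t. c * t powr \<alpha>)"
  shows "f \<in> RV \<alpha>"
proof -
  have lim: "((\<lambda>t. f t / (c * t powr \<alpha>)) \<longlongrightarrow> 1) at_top"
    by (rule asymp_equivD_strong[OF equiv eventually_mono[OF eventually_gt_at_top[of 0]]])
       (use c in simp)
  have "\<forall>\<^sub>F t in at_top. f t / (c * t powr \<alpha>) > 0"
    by (rule order_tendstoD(1)[OF lim]) simp
  then have pos: "\<forall>\<^sub>F t in at_top. f t > 0"
    using eventually_gt_at_top[of 0]
  proof eventually_elim
    case (elim t)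
    have "c * t powr \<alpha> > 0"
      using c elim(2) by simp
    then show ?case
      using elim(1) by (simp add: zero_less_divide_iff)
  qed
  have "((\<lambda>t. f (t * u) / f t) \<longlongrightarrow> u powr \<alpha>) at_top" if u: "u > 0" for u
  proof -
    have "filterlim (\<lambda>t. t * u) at_top at_top"
      using u by (simp add: filterlim_at_top_mult_tendsto_pos[OF tendsto_const _ filterlim_ident])
    then have lim_u: "((\<lambda>t. f (t * u) / (c * (t * u) powr \<alpha>)) \<longlongrightarrow> 1) at_top"
      by (rule filterlim_compose[OF lim])
    have "((\<lambda>t. f (t * u) / (c * (t * u) powr \<alpha>) / (f t / (c * t powr \<alpha>)) * u powr \<alpha>)
        \<longlongrightarrow> 1 / 1 * u powr \<alpha>) at_top"
      by (intro tendsto_intros lim lim_u) simp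
    moreover have "\<forall>\<^sub>F t in at_top.
        f (t * u) / (c * (t * u) powr \<alpha>) / (f t / (c * t powr \<alpha>)) * u powr \<alpha> = f (t * u) / f t"
      using eventually_gt_at_top[of 0] pos
      by eventually_elim (use u c in \<open>simp add: powr_mult field_simps\<close>)
    ultimately show ?thesis
      by (simp add: Lim_transform_eventually)
  qed
  with meas pos show ?thesis
    by (simp add: RV_def)
qed

section \<open>The generalised inverse of an ultimately increasing function\<close>

text \<open>Points below the cutoff \<open>x\<^sub>0\<close> are left out, as nothing is known about the monotonicity of \<open>f\<close>
  there.\<close>

definition gen_inverse :: "real \<Rightarrow> (real \<Rightarrow> real) \<Rightarrow> real \<Rightarrow> real" where
  "gen_inverse x\<^sub>0 f x = Sup {t. x\<^sub>0 \<le> t \<and> f t \<le> x}"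

context
  fixes f :: "real \<Rightarrow> real" and k x\<^sub>0 :: real
  assumes f: "f \<in> RV k" and k: "k > 0" and mono: "mono_on {x\<^sub>0..} f"
begin

lemma ultimately_above: "\<exists>T\<ge>x\<^sub>0. \<forall>t\<ge>T. f t > x"
proof -
  have "\<forall>\<^sub>F t in at_top. f t > x"
    using RV_mono_at_top[OF f k mono] by (simp add: filterlim_at_top_dense)
  then obtain T where "\<forall>t\<ge>T. f t > x"
    by (auto simp: eventually_at_top_linorder)
  then show ?thesis
    by (intro exI[of _ "max T x\<^sub>0"]) auto
qed

lemma bdd_above_sublevel: "bdd_above {t. x\<^sub>0 \<le> t \<and> f t \<le> x}"
proof -
  obtain T where "\<forall>t\<ge>T. f t > x"
    using ultimately_above by blast
  then have "t \<le> T" if "f t \<le> x" for t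
    using that by (metis leD linear)
  then show ?thesis
    by (intro bdd_aboveI[of _ T]) auto
qed

lemma le_gen_inverse: "x\<^sub>0 \<le> t \<Longrightarrow> f t \<le> x \<Longrightarrow> t \<le> gen_inverse x\<^sub>0 f x"
  unfolding gen_inverse_def by (intro cSup_upper bdd_above_sublevel) simp

lemma le_of_less_gen_inverse:
  assumes "x\<^sub>0 \<le> t" "t < gen_inverse x\<^sub>0 f x" "f x\<^sub>0 \<le> x"
  shows "f t \<le> x"
proof -
  have "{t. x\<^sub>0 \<le> t \<and> f t \<le> x} \<noteq> {}"
    using assms(3) by auto
  then obtain s where "x\<^sub>0 \<le> s" "f s \<le> x" "t < s"
    using assms(2) less_cSup_iff[OF _ bdd_above_sublevel] unfolding gen_inverse_def by blast
  moreover have "f t \<le> f s"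
    using mono assms(1) \<open>t < s\<close> by (auto simp: mono_on_def)
  ultimately show ?thesis
    by simp
qed

lemma gen_inverse_at_top: "filterlim (gen_inverse x\<^sub>0 f) at_top at_top"
  unfolding filterlim_at_top
proof
  fix Z
  show "\<forall>\<^sub>F x in at_top. Z \<le> gen_inverse x\<^sub>0 f x"
    using eventually_ge_at_top[of "f (max Z x\<^sub>0)"]
    by eventually_elim (use le_gen_inverse[of "max Z x\<^sub>0"] in auto)
qed

lemma multiple_gen_inverse_at_top:
  "c > 0 \<Longrightarrow> filterlim (\<lambda>x. c * gen_inverse x\<^sub>0 f x) at_top at_top"
  by (rule filterlim_tendsto_pos_mult_at_top[OF tendsto_const _ gen_inverse_at_top])

text \<open>With \<open>w\<close> strictly between \<open>u powr (1 / k)\<close> and \<open>v\<close>, the point \<open>y = (v / w) * h x\<close> lies beyond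
  \<open>h x\<close>, so \<open>f y > x\<close>; the ratio \<open>f (w * y) / f y\<close> tends to \<open>w powr k > u\<close>, and \<open>w * y = v * h x\<close>.\<close>

lemma above_level_at_multiple_of_inverse:
  assumes u: "u > 0" and v: "u powr (1 / k) < v"
  shows "\<forall>\<^sub>F x in at_top. u * x < f (v * gen_inverse x\<^sub>0 f x)"
proof -
  obtain w where w: "u powr (1 / k) < w" "w < v"
    using dense[OF v] by blast
  have w0: "w > 0" "v > 0"
    using w by (smt (verit) powr_ge_zero)+
  have "(u powr (1 / k)) powr k < w powr k"
    using w k by (intro powr_less_mono2) auto
  then have less: "u < w powr k"
    using u k by (simp add: powr_powr)
  define y where "y x = v / w * gen_inverse x\<^sub>0 f x" for x
  have y: "filterlim y at_top at_top"
    unfolding y_def using w0 by (intro multiple_gen_inverse_at_top) simp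
  have "\<forall>\<^sub>F x in at_top. u < f (w * y x) / f (y x)"
    by (rule order_tendstoD(1)[OF RV_tendsto_along[OF f w0(1) y] less])
  moreover have "\<forall>\<^sub>F x in at_top. f (y x) > 0"
    by (rule eventually_compose_filterlim[OF RV_pos[OF f] y])
  moreover have "\<forall>\<^sub>F x in at_top. gen_inverse x\<^sub>0 f x \<ge> max x\<^sub>0 1"
    using gen_inverse_at_top unfolding filterlim_at_top by blast
  ultimately show ?thesis
  proof eventually_elim
    case (elim x)
    have "gen_inverse x\<^sub>0 f x < y x"
      using elim(3) w w0 by (simp add: y_def field_simps)
    then have "x < f (y x)"
      using le_gen_inverse[of "y x" x] elim(3) by force
    then have "u * x < u * f (y x)"
      using u by simp
    also have "\<dots> < f (w * y x)"
      using elim(1,2) by (simp add: field_simps)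
    also have "w * y x = v * gen_inverse x\<^sub>0 f x"
      using w0 by (simp add: y_def)
    finally show ?case .
  qed
qed

lemma below_level_at_multiple_of_inverse:
  assumes u: "u > 0" and v: "0 < v" "v < u powr (1 / k)"
  shows "\<forall>\<^sub>F x in at_top. f (v * gen_inverse x\<^sub>0 f x) < u * x"
proof -
  obtain w where w: "v < w" "w < u powr (1 / k)"
    using dense[OF v(2)] by blast
  have w0: "w > 0"
    using v w by simp
  have "w powr k < (u powr (1 / k)) powr k"
    using w w0 k by (intro powr_less_mono2) auto
  then have less: "w powr k < u"
    using u k by (simp add: powr_powr)
  define y where "y x = v / w * gen_inverse x\<^sub>0 f x" for x
  have y: "filterlim y at_top at_top"
    unfolding y_def using w0 v by (intro multiple_gen_inverse_at_top) simp
  have "\<forall>\<^sub>F x in at_top. f (w * y x) / f (y x) < u"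
    by (rule order_tendstoD(2)[OF RV_tendsto_along[OF f w0(1) y] less])
  moreover have "\<forall>\<^sub>F x in at_top. f (y x) > 0"
    by (rule eventually_compose_filterlim[OF RV_pos[OF f] y])
  moreover have "\<forall>\<^sub>F x in at_top. y x \<ge> max x\<^sub>0 1"
    using y unfolding filterlim_at_top by blast
  moreover have "\<forall>\<^sub>F x in at_top. gen_inverse x\<^sub>0 f x \<ge> 1"
    using gen_inverse_at_top by (simp add: filterlim_at_top)
  ultimately show ?thesis
    using eventually_ge_at_top[of "f x\<^sub>0"]
  proof eventually_elim
    case (elim x)
    have "y x < gen_inverse x\<^sub>0 f x"
      using elim(4) w w0 by (simp add: y_def field_simps)
    then have "f (y x) \<le> x"
      using le_of_less_gen_inverse[of "y x" x] elim(3,5) by simp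
    have "v * gen_inverse x\<^sub>0 f x = w * y x"
      using w0 by (simp add: y_def)
    then have "f (v * gen_inverse x\<^sub>0 f x) < u * f (y x)"
      using elim(1,2) by (simp add: field_simps)
    also have "\<dots> \<le> u * x"
      using u \<open>f (y x) \<le> x\<close> by simp
    finally show ?case .
  qed
qed

section \<open>The mass of sublevel sets\<close>

context
  fixes \<nu> :: "real measure" and \<beta> :: real
  assumes sets: "sets \<nu> = sets borel" and fin: "\<And>x. emeasure \<nu> {..x} < \<infinity>"
    and N: "(\<lambda>x. measure \<nu> {..x}) \<in> RV \<beta>" and \<beta>: "\<beta> > 0"
begin

lemma fmeasurable_halfline: "{..x} \<in> fmeasurable \<nu>"
  using fin by (simp add: fmeasurable_def sets)

lemma fmeasurable_sublevel: "{t. f t \<le> x} \<in> fmeasurable \<nu>"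
proof -
  have "f \<in> borel_measurable borel"
    using f by (simp add: RV_def)
  then have meas: "{t. f t \<le> x} \<in> sets \<nu>"
    unfolding sets by measurable
  obtain T where "\<forall>t\<ge>T. f t > x"
    using ultimately_above by blast
  then have "t \<le> T" if "f t \<le> x" for t
    using that by (metis leD linear)
  then have "{t. f t \<le> x} \<subseteq> {..T}"
    by auto
  then show ?thesis
    using fmeasurableI2[OF fmeasurable_halfline _ meas] by simp
qed

lemma mono_mass_sublevel: "mono (\<lambda>x. measure \<nu> {t. f t \<le> x})"
  by (intro monoI measure_mono_fmeasurable) (auto simp: fmeasurable_sublevel fmeasurableD)

lemma mass_halfline_at_top: "filterlim (\<lambda>x. measure \<nu> {..x}) at_top at_top"
  by (rule RV_mono_at_top[OF N \<beta>, of 0])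
     (auto intro!: mono_onI measure_mono_fmeasurable simp: fmeasurable_halfline fmeasurableD)

text \<open>The upper estimate holds because \<open>{f \<le> u * x}\<close> ends before \<open>v * h x\<close> for
  \<open>v > u powr (1 / k)\<close>. For \<open>v < u powr (1 / k)\<close> it contains all of \<open>{..v * h x}\<close> beyond \<open>x\<^sub>0\<close>, and
  the mass of \<open>{..x\<^sub>0}\<close> is negligible against \<open>N (h x)\<close>.\<close>

lemma mass_sublevel_over_inverse_tendsto:
  assumes u: "u > 0"
  shows "((\<lambda>x. measure \<nu> {t. f t \<le> u * x} / measure \<nu> {..gen_inverse x\<^sub>0 f x})
           \<longlongrightarrow> u powr (\<beta> / k)) at_top"
proof -
  define h where "h = gen_inverse x\<^sub>0 f"
  define M where "M x = measure \<nu> {..x}" for x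
  have M_at_top: "filterlim (\<lambda>x. M (h x)) at_top at_top"
    unfolding M_def h_def by (rule filterlim_compose[OF mass_halfline_at_top gen_inverse_at_top])
  then have M_pos: "\<forall>\<^sub>F x in at_top. M (h x) > 0"
    by (simp add: filterlim_at_top_dense)
  have ratio: "((\<lambda>x. M (v * h x) / M (h x)) \<longlongrightarrow> v powr \<beta>) at_top" if "v > 0" for v
    unfolding M_def h_def by (rule RV_tendsto_along[OF N that gen_inverse_at_top])
  have beyond: "\<forall>\<^sub>F x in at_top. x\<^sub>0 \<le> v * h x" if "v > 0" for v
    using multiple_gen_inverse_at_top[OF that] by (simp add: filterlim_at_top h_def)
  have upow: "u powr (\<beta> / k) = (u powr (1 / k)) powr \<beta>"
    by (simp add: powr_powr)
  have "((\<lambda>x. measure \<nu> {t. f t \<le> u * x} / M (h x)) \<longlongrightarrow> u powr (\<beta> / k)) at_top"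
  proof (rule order_tendstoI)
    fix y assume y: "u powr (\<beta> / k) < y"
    have y0: "y > 0"
      using y by (smt (verit) powr_ge_zero)
    have "u powr (1 / k) < y powr (1 / \<beta>)"
      using powr_less_mono2[of "1 / \<beta>", OF _ _ y] \<beta> by (simp add: powr_powr)
    then obtain v where v: "u powr (1 / k) < v" "v < y powr (1 / \<beta>)"
      using dense by blast
    have v0: "v > 0"
      using v by (smt (verit) powr_ge_zero)
    have "v powr \<beta> < y"
      using powr_less_mono2[of \<beta>, OF _ _ v(2)] \<beta> v0 y0 by (simp add: powr_powr)
    then have "\<forall>\<^sub>F x in at_top. M (v * h x) / M (h x) < y"
      by (rule order_tendstoD(2)[OF ratio[OF v0]])
    moreover note M_pos beyond[OF v0] above_level_at_multiple_of_inverse[OF u v(1), folded h_def]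
    ultimately show "\<forall>\<^sub>F x in at_top. measure \<nu> {t. f t \<le> u * x} / M (h x) < y"
    proof eventually_elim
      case (elim x)
      have "t \<le> v * h x" if "f t \<le> u * x" for t
      proof (rule ccontr)
        assume "\<not> t \<le> v * h x"
        then have "f (v * h x) \<le> f t"
          using mono elim(3) by (auto simp: mono_on_def)
        with elim(4) that show False
          by simp
      qed
      then have "measure \<nu> {t. f t \<le> u * x} \<le> M (v * h x)"
        unfolding M_def
        by (intro measure_mono_fmeasurable)
           (auto simp: fmeasurable_halfline fmeasurableD[OF fmeasurable_sublevel])
      then have "measure \<nu> {t. f t \<le> u * x} / M (h x) \<le> M (v * h x) / M (h x)"
        using elim(2) by (simp add: divide_right_mono)
      with elim(1) show ?case
        by simp
    qed
  next
    fix y assume y: "y < u powr (\<beta> / k)"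
    \<comment> \<open>The maximum only serves to give the real power a nonnegative base.\<close>
    define y' where "y' = max y 0"
    have y': "y' < u powr (\<beta> / k)" "y' \<ge> 0" "y \<le> y'"
      using y u by (auto simp: y'_def)
    have "y' powr (1 / \<beta>) < u powr (1 / k)"
      using powr_less_mono2[of "1 / \<beta>", OF _ _ y'(1)] \<beta> y'(2) by (simp add: powr_powr)
    then obtain v where v: "y' powr (1 / \<beta>) < v" "v < u powr (1 / k)"
      using dense by blast
    have v0: "v > 0"
      using v by (smt (verit) powr_ge_zero)
    have "y' < v powr \<beta>"
      using powr_less_mono2[of \<beta>, OF _ _ v(1)] \<beta> v0 y'(2) by (simp add: powr_powr)
    then have less: "y < v powr \<beta> - 0"
      using y'(3) by simp
    have "((\<lambda>x. M (v * h x) / M (h x) - M x\<^sub>0 / M (h x)) \<longlongrightarrow> v powr \<beta> - 0) at_top"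
      by (intro tendsto_diff ratio v0 tendsto_divide_0[OF tendsto_const]
            filterlim_at_top_imp_at_infinity M_at_top)
    then have "\<forall>\<^sub>F x in at_top. y < M (v * h x) / M (h x) - M x\<^sub>0 / M (h x)"
      by (rule order_tendstoD(1)[OF _ less])
    moreover note M_pos beyond[OF v0] below_level_at_multiple_of_inverse[OF u v0 v(2), folded h_def]
    ultimately show "\<forall>\<^sub>F x in at_top. y < measure \<nu> {t. f t \<le> u * x} / M (h x)"
    proof eventually_elim
      case (elim x)
      have "f t \<le> u * x" if "t \<le> v * h x" "\<not> t \<le> x\<^sub>0" for t
      proof -
        have "f t \<le> f (v * h x)"
          using mono elim(3) that by (auto simp: mono_on_def)
        with elim(4) show ?thesis
          by simp
      qed
      then have "{..v * h x} \<subseteq> {..x\<^sub>0} \<union> {t. f t \<le> u * x}"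
        by auto
      then have "M (v * h x) \<le> measure \<nu> ({..x\<^sub>0} \<union> {t. f t \<le> u * x})"
        unfolding M_def
        by (intro measure_mono_fmeasurable fmeasurable.Un fmeasurable_halfline fmeasurable_sublevel)
           (auto simp: fmeasurableD[OF fmeasurable_halfline])
      also have "\<dots> \<le> M x\<^sub>0 + measure \<nu> {t. f t \<le> u * x}"
        unfolding M_def
        by (intro measure_Un_le fmeasurableD fmeasurable_halfline fmeasurable_sublevel)
      finally have "(M (v * h x) - M x\<^sub>0) / M (h x) \<le> measure \<nu> {t. f t \<le> u * x} / M (h x)"
        using elim(2) by (intro divide_right_mono) auto
      with elim(1) show ?case
        by (simp add: diff_divide_distrib)
    qed
  qed
  then show ?thesis
    by (simp add: M_def h_def)
qed

lemma mass_sublevel_RV: "(\<lambda>x. measure \<nu> {t. f t \<le> x}) \<in> RV (\<beta> / k)"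
proof -
  let ?F = "\<lambda>x. measure \<nu> {t. f t \<le> x}" and ?M = "\<lambda>x. measure \<nu> {..gen_inverse x\<^sub>0 f x}"
  have M_pos: "\<forall>\<^sub>F x in at_top. ?M x > 0"
    using filterlim_compose[OF mass_halfline_at_top gen_inverse_at_top]
    by (simp add: filterlim_at_top_dense)
  have one: "((\<lambda>x. ?F x / ?M x) \<longlongrightarrow> 1) at_top"
    using mass_sublevel_over_inverse_tendsto[of 1] by simp
  have "\<forall>\<^sub>F x in at_top. ?F x / ?M x > 0"
    by (rule order_tendstoD(1)[OF one]) simp
  then have pos: "\<forall>\<^sub>F x in at_top. ?F x > 0"
    using M_pos by eventually_elim (simp add: zero_less_divide_iff)
  have "((\<lambda>x. ?F (x * u) / ?F x) \<longlongrightarrow> u powr (\<beta> / k)) at_top" if "u > 0" for u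
  proof -
    have "((\<lambda>x. (?F (u * x) / ?M x) / (?F x / ?M x)) \<longlongrightarrow> u powr (\<beta> / k) / 1) at_top"
      by (intro tendsto_divide one mass_sublevel_over_inverse_tendsto[OF that]) simp
    moreover have "\<forall>\<^sub>F x in at_top. (?F (u * x) / ?M x) / (?F x / ?M x) = ?F (x * u) / ?F x"
      using M_pos by eventually_elim (simp add: mult.commute)
    ultimately show ?thesis
      by (simp add: Lim_transform_eventually)
  qed
  moreover have "?F \<in> borel_measurable borel"
    by (rule borel_measurable_mono[OF mono_mass_sublevel])
  ultimately show ?thesis
    using pos by (simp add: RV_def)
qed

lemma
  fixes a :: real
  defines "\<mu> \<equiv> distr \<nu> borel (\<lambda>x. a - f x)"
  shows counting_pushforward: "counting (above a) \<mu> = (\<lambda>x. measure \<nu> {t. f t \<le> x})"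
    and counted_by_pushforward: "counted_by (above a) \<mu>"
    and counting_pushforward_RV: "counting (above a) \<mu> \<in> RV (\<beta> / k)"
proof -
  have space: "space \<nu> = UNIV"
    using sets_eq_imp_space_eq[OF sets] by simp
  have "f \<in> borel_measurable borel"
    using f by (simp add: RV_def)
  then have g: "(\<lambda>x. a - f x) \<in> \<nu> \<rightarrow>\<^sub>M borel"
    unfolding measurable_cong_sets[OF sets refl] by measurable
  have vimage: "(\<lambda>x. a - f x) -` above a x \<inter> space \<nu> = {t. f t \<le> x}" for x
    by (auto simp: above_def space)
  have above: "above a x \<in> sets borel" for x
    by (simp add: above_def)
  show *: "counting (above a) \<mu> = (\<lambda>x. measure \<nu> {t. f t \<le> x})"
    by (rule ext) (simp add: counting_def \<mu>_def measure_distr[OF g above] vimage)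
  show "counting (above a) \<mu> \<in> RV (\<beta> / k)"
    unfolding * by (rule mass_sublevel_RV)
  show "counted_by (above a) \<mu>"
    unfolding counted_by_def *
    using mono_mass_sublevel fmeasurable_sublevel
    by (auto simp: \<mu>_def emeasure_distr[OF g above] vimage fmeasurable_def intro: mono_imp_mono_on)
qed

end

end

section \<open>Spectral measures with power-law counting functions\<close>

text \<open>Cardinalities of infinite sets are 0. An infinite count would persist at all higher levels and
  so contradict the positive growth.\<close>

lemma finite_of_counting_asymp:
  assumes c: "c > 0"
    and equiv: "(\<lambda>x. real (card {n. lam n \<le> x})) \<sim>[at_top] (\<lambda>x. c * x powr \<alpha>)"
  shows "finite {n. lam n \<le> (x::real)}"
proof (rule ccontr)
  assume inf: "infinite {n. lam n \<le> x}"
  have zero: "card {n. lam n \<le> y} = 0" if "y \<ge> x" for y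
  proof -
    have "{n. lam n \<le> x} \<subseteq> {n. lam n \<le> y}"
      using that by auto
    then show ?thesis
      using inf by (metis card.infinite infinite_super)
  qed
  have "\<forall>\<^sub>F y in at_top. real (card {n. lam n \<le> y}) = 0 \<longleftrightarrow> c * y powr \<alpha> = 0"
    by (rule asymp_equiv_eventually_zeros[OF equiv])
  moreover note eventually_ge_at_top[of x] eventually_gt_at_top[of "0::real"]
  ultimately have "\<forall>\<^sub>F y in at_top::real filter. False"
    by eventually_elim (use zero c in auto)
  then show False
    by simp
qed

lemma
  fixes lam :: "nat \<Rightarrow> real"
  assumes fin: "\<And>x. finite {n. lam n \<le> x}"
  shows counting_below_spectral_measure:
      "counting below (spectral_measure lam) = (\<lambda>x. real (card {n. lam n \<le> x}))"
    and counted_by_spectral_measure: "counted_by below (spectral_measure lam)"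
proof -
  show *: "counting below (spectral_measure lam) = (\<lambda>x. real (card {n. lam n \<le> x}))"
    using counting_spectral_measure[of lam below] fin by (simp add: fun_eq_iff below_def)
  show "counted_by below (spectral_measure lam)"
    unfolding counted_by_def
  proof (intro conjI allI exI)
    show "sets (spectral_measure lam) = sets borel"
      by (simp add: spectral_measure_def)
    show "emeasure (spectral_measure lam) (below x) < \<infinity>" for x
      using fin[of x]
      by (simp add: spectral_measure_def emeasure_distr below_def vimage_def of_nat_less_top)
    show "mono_on {0..} (counting below (spectral_measure lam))"
      unfolding * by (auto intro!: mono_onI card_mono fin)
  qed
qed

theorem proposition4p2:
  fixes X :: "'m topology"
    and A :: "('m, 'd::finite) chart set"
    and G :: "('m, 'd) chart \<Rightarrow> real ^ 'd \<Rightarrow> real ^ 'd ^ 'd"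
    and lam :: "nat \<Rightarrow> real"
    and \<phi> g :: "real \<Rightarrow> real"
    and \<gamma> a k d :: real
    and \<mu>\<^sub>\<Delta> \<mu>\<^sub>g :: "real measure"
    and T\<^sub>g :: "real measure \<Rightarrow> real measure"
  assumes "closed_riemannian_manifold X A G"
    and "d = real CARD('d)"
    and "laplace_eigenvalues X A G lam"
    and "\<gamma> > 0"
    and "(\<lambda>\<Lambda>. real (card {n. lam n \<le> \<Lambda>})) \<sim>[at_top] (\<lambda>\<Lambda>. \<gamma> * \<Lambda> powr (d / 2))"
    and "k > 0"
    and "\<phi> \<in> RV k"
    and "g = (\<lambda>x. a - \<phi> x)"
    and "\<exists>x\<^sub>0. strict_antimono_on {x\<^sub>0..} g"
    and "\<mu>\<^sub>\<Delta> = spectral_measure lam"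
    and "T\<^sub>g = (\<lambda>\<mu>. distr \<mu> borel g)"
    and "\<mu>\<^sub>g = T\<^sub>g \<mu>\<^sub>\<Delta>"
  shows "(\<lambda>x. real (card {n. g (lam n) \<ge> a - x})) \<in> RV (d / (2 * k))
    \<and> \<mu>\<^sub>\<Delta> \<in> as_class below (d / 2) \<mu>\<^sub>\<Delta>
    \<and> T\<^sub>g \<in> as_class below (d / 2) \<mu>\<^sub>\<Delta> \<rightarrow> as_class (above a) (d / (2 * k)) \<mu>\<^sub>g
    \<and> (\<forall>\<nu> \<in> as_class below (d / 2) \<mu>\<^sub>\<Delta>. as_dim (above a) (T\<^sub>g \<nu>) = 1 / k * as_dim below \<nu>)
    \<and> as_dim (above a) \<mu>\<^sub>g = 1 / k * as_dim below \<mu>\<^sub>\<Delta>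
    \<and> 1 / k * as_dim below \<mu>\<^sub>\<Delta> = d / k"
proof -
  note closed = assms(4,5) and k = assms(6) and \<phi> = assms(7) and g = assms(8)
    and \<mu>\<^sub>\<Delta> = assms(10) and T = assms(11) and \<mu>\<^sub>g = assms(12)
  have d: "d > 0"
    using assms(2) by simp
  obtain x\<^sub>0 where "strict_antimono_on {x\<^sub>0..} g"
    using assms(9) by blast
  then have mono: "mono_on {x\<^sub>0..} \<phi>"
    unfolding g by (fastforce simp: monotone_on_def order_le_less)
  have index: "d / 2 / k = d / (2 * k)"
    by simp
  have push: "counted_by (above a) (T\<^sub>g \<nu>)" "counting (above a) (T\<^sub>g \<nu>) \<in> RV (d / (2 * k))"
      "counting (above a) (T\<^sub>g \<nu>) = (\<lambda>x. measure \<nu> {t. \<phi> t \<le> x})"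
      "\<And>x. emeasure \<nu> {t. \<phi> t \<le> x} < \<infinity>"
    if "counted_by below \<nu>" "counting below \<nu> \<in> RV (d / 2)" for \<nu>
  proof -
    have \<nu>: "sets \<nu> = sets borel" "\<And>x. emeasure \<nu> {..x} < \<infinity>"
      "(\<lambda>x. measure \<nu> {..x}) \<in> RV (d / 2)" "d / 2 > 0"
      using that d by (auto simp: counted_by_def below_def counting_def[abs_def])
    show "counted_by (above a) (T\<^sub>g \<nu>)"
      unfolding T g by (rule counted_by_pushforward[OF \<phi> k mono \<nu>])
    show "counting (above a) (T\<^sub>g \<nu>) \<in> RV (d / (2 * k))"
      unfolding T g index[symmetric] by (rule counting_pushforward_RV[OF \<phi> k mono \<nu>])
    show "counting (above a) (T\<^sub>g \<nu>) = (\<lambda>x. measure \<nu> {t. \<phi> t \<le> x})"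
      unfolding T g by (rule counting_pushforward[OF \<phi> k mono \<nu>])
    show "emeasure \<nu> {t. \<phi> t \<le> x} < \<infinity>" for x
      using fmeasurable_sublevel[OF \<phi> k mono \<nu>] by (simp add: fmeasurable_def)
  qed
  have fin: "finite {n. lam n \<le> x}" for x
    by (rule finite_of_counting_asymp[OF closed])
  have counted: "counted_by below \<mu>\<^sub>\<Delta>"
    unfolding \<mu>\<^sub>\<Delta> by (rule counted_by_spectral_measure[OF fin])
  have "mono (\<lambda>x. real (card {n. lam n \<le> x}))"
    by (auto intro!: monoI card_mono fin)
  then have RV: "counting below \<mu>\<^sub>\<Delta> \<in> RV (d / 2)"
    unfolding \<mu>\<^sub>\<Delta> counting_below_spectral_measure[OF fin]
    by (rule asymp_equiv_power_imp_RV[OF borel_measurable_mono closed])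
  have class_eq: "\<nu> \<in> as_class below (d / 2) \<mu>\<^sub>\<Delta>
      \<longleftrightarrow> counted_by below \<nu> \<and> counting below \<nu> \<in> RV (d / 2)" for \<nu>
    using counted RV d by (auto simp: as_class_def as_equiv_def)
  have "measure \<mu>\<^sub>\<Delta> {t. \<phi> t \<le> x} = real (card {n. g (lam n) \<ge> a - x})" for x
  proof -
    have "\<phi> \<in> borel_measurable borel"
      using \<phi> by (simp add: RV_def)
    then have meas: "{t. \<phi> t \<le> x} \<in> sets borel"
      by measurable
    have "emeasure (count_space UNIV) {n. \<phi> (lam n) \<le> x} < \<infinity>"
      using push(4)[OF counted RV, of x] meas
      by (simp add: \<mu>\<^sub>\<Delta> spectral_measure_def emeasure_distr vimage_def)
    then have "finite {n. \<phi> (lam n) \<le> x}"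
      by (auto simp: emeasure_count_space split: if_splits)
    then show ?thesis
      using meas
      by (simp add: \<mu>\<^sub>\<Delta> g spectral_measure_def measure_distr vimage_def)
  qed
  then have "(\<lambda>x. real (card {n. g (lam n) \<ge> a - x})) \<in> RV (d / (2 * k))"
    using push(2,3)[OF counted RV] by simp
  moreover have "\<mu>\<^sub>\<Delta> \<in> as_class below (d / 2) \<mu>\<^sub>\<Delta>"
    using class_eq counted RV by blast
  moreover have "T\<^sub>g \<in> as_class below (d / 2) \<mu>\<^sub>\<Delta> \<rightarrow> as_class (above a) (d / (2 * k)) \<mu>\<^sub>g"
    using push(1,2) counted RV class_eq d k by (auto simp: as_class_def[of "above a"] as_equiv_def \<mu>\<^sub>g)
  moreover have dims: "as_dim below \<nu> = d" "as_dim (above a) (T\<^sub>g \<nu>) = d / k"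
    if "\<nu> \<in> as_class below (d / 2) \<mu>\<^sub>\<Delta>" for \<nu>
    using as_dim_eq[of below \<nu>] as_dim_eq[OF push(2), of \<nu>] class_eq that by auto
  ultimately show ?thesis
    by (simp add: \<mu>\<^sub>g)
qed

end
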